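(* Let $A=\operatorname{diag}(\lambda_1,\dots,\lambda_n)$ with pairwise distinct $\lambda_i\in\mathbb C$, and let $C=C(p^* )$ be a critical torus with active support $S$, center $c$ and radius $R$. The eigenvalues that lie strictly inside the critical circle correspond to unstable directions, while those that lie strictly outside the circle correspond to stable directions. Namely, for $k\notin S$, \[ |\lambda_k-c|<R\iff\text{the inactive coordinate }k\text{ is unstable}, \] \[ |\lambda_k-c|>R\iff\text{the inactive coordinate }k\text{ is stable}. \]
   Context: For a unit vector $u\in\mathbb C^n$, $z=u^*Au$, $\rho_A(u)=\|Au-zu\|^2$, regarded as a function on $\mathbb{CP}^{n-1}$. The residual flow is the negative gradient flow $\dot u=-2\left((A^*-\overline zI)(A-zI)u-\rho_A(u)u\right)$. With $p_i=|u_i|^2$, $z(p)=\sum_ip_i\lambda_i$, $\rho(p)=\sum_ip_i|\lambda_i-z(p)|^2$, a critical torus $C(p^* )$ is the set of $[u]\in\mathbb{CP}^{n-1}$ with $|u_i|^2=p^*_i$ for all $i$, where these points are critical for $\rho_A$. Put $S=\{i:p_i^*>0\}$ (active indices), $c=z(p^* )$, $R^2=\rho(p^* )$ with $R\ge0$; then $|\lambda_i-c|=R$ for $i\in S$. The critical circle has center $c$ and radius $R$. For an inactive index $k\notin S$, $u_k$ is a local complex coordinate transverse to $C$; the inactive coordinate $k$ is called unstable (resp. stable) if the linearization of the flow at $C$ acts on the coordinate $u_k$ as multiplication by a positive (resp. negative) real number, in both real directions. *)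

theory Defs
  imports "HOL-Analysis.Analysis"
begin

definition cinner :: "complex^'n \<Rightarrow> complex^'n \<Rightarrow> complex" where
  "cinner u v = (\<Sum>i\<in>UNIV. cnj (u $ i) * v $ i)"

definition ctranspose :: "complex^'n^'m \<Rightarrow> complex^'m^'n" where
  "ctranspose A = (\<chi> i j. cnj (A $ j $ i))"

definition diag_mat :: "('n \<Rightarrow> complex) \<Rightarrow> complex^'n^'n" where
  "diag_mat l = (\<chi> i j. if i = j then l i else 0)"

definition rayleigh :: "complex^'n^'n \<Rightarrow> complex^'n \<Rightarrow> complex" where
  "rayleigh A u = cinner u (A *v u)"

definition residual :: "complex^'n^'n \<Rightarrow> complex^'n \<Rightarrow> real" where
  "residual A u = (norm (A *v u - rayleigh A u *s u))\<^sup>2"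

text \<open>
  A point of complex projective space is a complex line through the origin; \<open>cp_point u\<close>
  is the point with homogeneous coordinates \<open>u\<close> (meant for nonzero \<open>u\<close>).
\<close>

definition cp_point :: "complex^'n \<Rightarrow> (complex^'n) set" where
  "cp_point u = range (\<lambda>s. s *s u)"

text \<open>
  On unit vectors \<open>residual A\<close> is invariant under phases, so it is a function on projective
  space. Its pullback along the submersion sending a nonzero \<open>v\<close> to \<open>cp_point v\<close> is
  \<open>residual A (sgn v)\<close>, where \<open>sgn v\<close> is the normalisation of \<open>v\<close>; a point is critical iff the
  real derivative of the pullback vanishes at its representatives.
\<close>

definition residual_critical :: "complex^'n^'n \<Rightarrow> (complex^'n) set \<Rightarrow> bool" where
  "residual_critical A P \<longleftrightarrow>
     (\<forall>u. u \<noteq> 0 \<and> cp_point u = P \<longrightarrow>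
        ((\<lambda>v. residual A (sgn v)) has_derivative (\<lambda>_. 0)) (at u))"

text \<open>
  The right-hand side of the residual flow. For unit \<open>u\<close> it is orthogonal to \<open>u\<close> and commutes
  with phases, so it is the horizontal lift of a vector field on projective space.
\<close>

definition residual_field :: "complex^'n^'n \<Rightarrow> complex^'n \<Rightarrow> complex^'n" where
  "residual_field A u =
     (- 2) *\<^sub>R ((ctranspose A - mat (cnj (rayleigh A u))) *v ((A - mat (rayleigh A u)) *v u)
               - residual A u *\<^sub>R u)"

text \<open>
  The tangent space of projective space at the point of a unit vector \<open>u\<close>, in its
  horizontal model.
\<close>

definition cp_tangent :: "complex^'n \<Rightarrow> (complex^'n) set" where
  "cp_tangent u = {w. cinner u w = 0}"

definition prob_simplex :: "('n::finite \<Rightarrow> real) set" where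
  "prob_simplex = {p. (\<forall>i. 0 \<le> p i) \<and> (\<Sum>i\<in>UNIV. p i) = 1}"

definition z_of :: "('n::finite \<Rightarrow> complex) \<Rightarrow> ('n \<Rightarrow> real) \<Rightarrow> complex" where
  "z_of l p = (\<Sum>i\<in>UNIV. of_real (p i) * l i)"

definition rho_of :: "('n::finite \<Rightarrow> complex) \<Rightarrow> ('n \<Rightarrow> real) \<Rightarrow> real" where
  "rho_of l p = (\<Sum>i\<in>UNIV. p i * (cmod (l i - z_of l p))\<^sup>2)"

text \<open>For \<open>p\<close> in the simplex the representatives \<open>u\<close> below are automatically unit vectors.\<close>

definition torus :: "('n::finite \<Rightarrow> real) \<Rightarrow> (complex^'n) set set" where
  "torus p = {cp_point u | u. \<forall>i. (cmod (u $ i))\<^sup>2 = p i}"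

definition critical_torus :: "complex^'n^'n \<Rightarrow> ('n \<Rightarrow> real) \<Rightarrow> bool" where
  "critical_torus A p \<longleftrightarrow> p \<in> prob_simplex \<and> (\<forall>P\<in>torus p. residual_critical A P)"

definition active :: "('n \<Rightarrow> real) \<Rightarrow> 'n set" where
  "active p = {i. p i > 0}"

text \<open>
  The linearization of the flow at a critical point \<open>cp_point u\<close>, \<open>norm u = 1\<close>, is the real
  derivative of the vector field on \<open>cp_tangent u\<close>, which it maps to itself because the
  field vanishes at \<open>u\<close>. Tangent vectors are tangent to the unit sphere, so the values there do
  not depend on how the field is extended off the sphere.

  That it acts on the coordinate \<open>k\<close> as multiplication by the real number \<open>\<mu>\<close> means: the linearized
  equation for that coordinate is \<open>w' = \<mu> w\<close>, whatever the other coordinates do, and the complex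
  \<open>k\<close>-axis (both of its real directions) consists of eigenvectors for \<open>\<mu>\<close>. For an inactive \<open>k\<close> that
  axis lies in \<open>cp_tangent u\<close>.
\<close>

definition linearization_multiplies ::
  "complex^'n^'n \<Rightarrow> ('n \<Rightarrow> real) \<Rightarrow> 'n \<Rightarrow> real \<Rightarrow> bool" where
  "linearization_multiplies A p k \<mu> \<longleftrightarrow>
     (\<forall>u. norm u = 1 \<and> cp_point u \<in> torus p \<longrightarrow>
        (let L = frechet_derivative (residual_field A) (at u) in
           (\<forall>w\<in>cp_tangent u. L w $ k = \<mu> *\<^sub>R (w $ k)) \<and>
           (\<forall>v. L (axis k v) = \<mu> *\<^sub>R axis k v)))"

definition unstable_coord :: "complex^'n^'n \<Rightarrow> ('n \<Rightarrow> real) \<Rightarrow> 'n \<Rightarrow> bool" where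
  "unstable_coord A p k \<longleftrightarrow> (\<exists>\<mu>>0. linearization_multiplies A p k \<mu>)"

definition stable_coord :: "complex^'n^'n \<Rightarrow> ('n \<Rightarrow> real) \<Rightarrow> 'n \<Rightarrow> bool" where
  "stable_coord A p k \<longleftrightarrow> (\<exists>\<mu><0. linearization_multiplies A p k \<mu>)"

end

theory Submission
  imports Defs
begin

text \<open>
  For a diagonal matrix the residual flow decouples up to real scalar factors: its right-hand
  side has the coordinates \<open>\<gamma>\<^sub>i v\<^sub>i\<close> with \<open>\<gamma>\<^sub>i = 2 (\<rho> - \<bar>\<lambda>\<^sub>i - z\<bar>\<^sup>2)\<close>
  (lemma \<open>residual_field_diag\<close>), and \<open>\<gamma>\<^sub>i\<close> sees \<open>v\<close> only through the squared moduli
  \<open>\<bar>v\<^sub>j\<bar>\<^sup>2\<close>. Linearise at \<open>u\<close> with \<open>u\<^sub>k = 0\<close>. The product rule gives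
  \<open>\<gamma>\<^sub>k(u) w\<^sub>k\<close> in coordinate \<open>k\<close>, because the term with the derivative of \<open>\<gamma>\<^sub>k\<close>
  carries the factor \<open>u\<^sub>k\<close>. Conversely, moving along the \<open>k\<close>-axis changes the squared moduli
  to second order only, so all \<open>\<gamma>\<^sub>i\<close> are stationary in that direction and the other
  coordinates do not react (lemma \<open>growth_rate_derivative\<close>).

  So the linearised flow multiplies coordinate \<open>k\<close> by the number \<open>\<gamma>\<^sub>k(u)\<close>, which at every point
  of the torus equals \<open>2 (R\<^sup>2 - \<bar>\<lambda>\<^sub>k - c\<bar>\<^sup>2)\<close>, and by no other number
  (lemma \<open>linearization_multiplies_iff\<close>). Its sign tells on which side of the critical circle
  \<open>\<lambda>\<^sub>k\<close> lies.
\<close>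

lemma diag_mat_mult_nth: "(diag_mat l *v v) $ i = l i * v $ i"
  by (simp add: diag_mat_def matrix_vector_mult_def if_distrib[of "\<lambda>x. x * _"] cong: if_cong)

lemma ctranspose_diag_mat: "ctranspose (diag_mat l) = diag_mat (\<lambda>i. cnj (l i))"
  by (simp add: ctranspose_def diag_mat_def vec_eq_iff)

lemma mat_mult_nth: "((mat a :: complex^'n^'n) *v v) $ i = a * v $ i"
  by (simp add: mat_def matrix_vector_mult_def if_distrib[of "\<lambda>x. x * _"] cong: if_cong)

lemma rayleigh_diag: "rayleigh (diag_mat l) v = z_of l (\<lambda>j. (cmod (v $ j))\<^sup>2)"
  unfolding rayleigh_def cinner_def z_of_def diag_mat_mult_nth
  by (intro sum.cong refl) (simp add: complex_norm_square mult_ac del: of_real_power)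

lemma residual_diag: "residual (diag_mat l) v = rho_of l (\<lambda>j. (cmod (v $ j))\<^sup>2)"
proof -
  have "residual (diag_mat l) v =
      (\<Sum>i\<in>UNIV. (cmod ((l i - z_of l (\<lambda>j. (cmod (v $ j))\<^sup>2)) * v $ i))\<^sup>2)"
    by (simp add: residual_def rayleigh_diag norm_vec_def L2_set_def sum_nonneg
        diag_mat_mult_nth left_diff_distrib)
  then show ?thesis
    by (simp add: rho_of_def norm_mult power_mult_distrib mult.commute)
qed

definition growth_rate :: "('n::finite \<Rightarrow> complex) \<Rightarrow> 'n \<Rightarrow> ('n \<Rightarrow> real) \<Rightarrow> real" where
  "growth_rate l i q = 2 * (rho_of l q - (cmod (l i - z_of l q))\<^sup>2)"

lemma residual_field_diag:
  "residual_field (diag_mat l) v $ i = growth_rate l i (\<lambda>j. (cmod (v $ j))\<^sup>2) *\<^sub>R (v $ i)"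
  by (simp add: residual_field_def growth_rate_def residual_diag rayleigh_diag
      ctranspose_diag_mat matrix_vector_mult_diff_rdistrib diag_mat_mult_nth mat_mult_nth
      scaleR_conv_of_real[where 'a = complex] complex_norm_square algebra_simps del: of_real_power)

text \<open>
  The squared modulus of a coordinate has derivative \<open>w \<mapsto> 2 (u\<^sub>j \<bullet> w\<^sub>j)\<close>, which vanishes on the
  \<open>k\<close>-axis: for \<open>j = k\<close> since \<open>u\<^sub>k = 0\<close>, and for \<open>j \<noteq> k\<close> since \<open>w\<^sub>j = 0\<close>. By the chain
  rule every differentiable function of the squared moduli inherits this.
\<close>

lemma growth_rate_derivative:
  fixes u :: "complex^'n"
  assumes "u $ k = 0"
  obtains D where
    "((\<lambda>v. growth_rate l i (\<lambda>j. (cmod (v $ j))\<^sup>2)) has_derivative D) (at u)"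
    "\<And>a. D (axis k a) = 0"
proof -
  define dz where "dz w = (\<Sum>j\<in>UNIV. of_real (2 * (u $ j \<bullet> w $ j)) * l j)" for w :: "complex^'n"
  define z where "z v = z_of l (\<lambda>j. (cmod (v $ j))\<^sup>2)" for v :: "complex^'n"
  have sq: "((\<lambda>v. (cmod (v $ j))\<^sup>2) has_derivative (\<lambda>w. 2 * (u $ j \<bullet> w $ j))) (at u)" for j
    unfolding power2_norm_eq_inner
    by (auto intro!: derivative_eq_intros
        bounded_linear.has_derivative[OF bounded_linear_vec_nth has_derivative_ident]
        simp: inner_commute)
  have dz: "(z has_derivative dz) (at u)"
    unfolding z_def[abs_def] z_of_def dz_def[abs_def]
    by (intro has_derivative_sum has_derivative_mult_left has_derivative_of_real sq)
  have dq: "((\<lambda>v. (cmod (l j - z v))\<^sup>2) has_derivative (\<lambda>w. - 2 * ((l j - z u) \<bullet> dz w))) (at u)"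
    for j
    unfolding power2_norm_eq_inner
    by (auto intro!: derivative_eq_intros dz simp: inner_commute)
  have axis0: "u $ j \<bullet> axis k a $ j = 0" for j a
    using assms by (simp add: axis_def)
  have dz0: "dz (axis k a) = 0" for a
    by (simp add: dz_def axis0)
  show thesis
  proof
    show "((\<lambda>v. growth_rate l i (\<lambda>j. (cmod (v $ j))\<^sup>2)) has_derivative
        (\<lambda>w. 2 * ((\<Sum>j\<in>UNIV. (cmod (u $ j))\<^sup>2 * (- 2 * ((l j - z u) \<bullet> dz w))
                     + 2 * (u $ j \<bullet> w $ j) * (cmod (l j - z u))\<^sup>2)
                  - (- 2 * ((l i - z u) \<bullet> dz w))))) (at u)"
      unfolding growth_rate_def rho_of_def z_def[symmetric]
      by (intro has_derivative_mult_right has_derivative_diff has_derivative_sum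
          has_derivative_mult sq dq)
  qed (simp add: dz0 axis0)
qed

lemma residual_field_derivative:
  fixes u :: "complex^'n" and l :: "'n \<Rightarrow> complex"
  assumes "u $ k = 0"
  defines "\<gamma> \<equiv> \<lambda>i. growth_rate l i (\<lambda>j. (cmod (u $ j))\<^sup>2)"
  defines "L \<equiv> frechet_derivative (residual_field (diag_mat l)) (at u)"
  shows "L w $ k = \<gamma> k *\<^sub>R (w $ k)" and "L (axis k a) = \<gamma> k *\<^sub>R axis k a"
proof -
  have "\<exists>D. ((\<lambda>v. growth_rate l i (\<lambda>j. (cmod (v $ j))\<^sup>2)) has_derivative D) (at u) \<and>
      (\<forall>a. D (axis k a) = 0)" for i
    using growth_rate_derivative[OF assms(1)] by metis
  then obtain D where D: "\<And>i. ((\<lambda>v. growth_rate l i (\<lambda>j. (cmod (v $ j))\<^sup>2)) has_derivative D i) (at u)"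
    and D0: "\<And>i a. D i (axis k a) = 0"
    by metis
  define F where "F w = (\<chi> i. \<gamma> i *\<^sub>R (w $ i) + D i w *\<^sub>R (u $ i))" for w
  have coord: "((\<lambda>v. residual_field (diag_mat l) v $ i) has_derivative (\<lambda>w. F w $ i)) (at u)" for i
    unfolding residual_field_diag F_def \<gamma>_def vec_lambda_beta
    by (intro has_derivative_scaleR D bounded_linear.has_derivative[OF bounded_linear_vec_nth]
        has_derivative_ident)
  have "(residual_field (diag_mat l) has_derivative F) (at u)"
  proof (subst has_derivative_componentwise_within, intro ballI)
    fix b :: "complex^'n"
    assume "b \<in> Basis"
    then obtain i c where b: "b = axis i c"
      by (auto simp: Basis_vec_def)
    show "((\<lambda>v. residual_field (diag_mat l) v \<bullet> b) has_derivative (\<lambda>w. F w \<bullet> b)) (at u)"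
      unfolding b inner_axis by (intro has_derivative_inner_left coord)
  qed
  then have L: "L = F"
    unfolding L_def by (rule frechet_derivative_at[symmetric])
  show "L w $ k = \<gamma> k *\<^sub>R (w $ k)"
    by (simp add: L F_def assms(1))
  have "axis k a $ i = (if i = k then a else 0)" for i
    by (simp add: axis_def)
  then show "L (axis k a) = \<gamma> k *\<^sub>R axis k a"
    by (simp add: L F_def D0 vec_eq_iff)
qed

text \<open>
  A unit representative differs from one with the prescribed moduli by a phase only.
\<close>

lemma torus_representative:
  fixes u :: "complex^'n"
  assumes "p \<in> prob_simplex" "norm u = 1" "cp_point u \<in> torus p"
  shows "(cmod (u $ i))\<^sup>2 = p i"
proof -
  obtain v where v: "cp_point u = cp_point v" "\<And>i. (cmod (v $ i))\<^sup>2 = p i"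
    using assms(3) by (auto simp: torus_def)
  have "u \<in> cp_point u"
    unfolding cp_point_def by (rule range_eqI[of _ _ 1]) simp
  then obtain s where s: "u = s *s v"
    unfolding v(1) by (auto simp: cp_point_def)
  have *: "(cmod (u $ j))\<^sup>2 = (cmod s)\<^sup>2 * p j" for j
    by (simp add: s norm_mult power_mult_distrib v(2))
  have "1 = (\<Sum>j\<in>UNIV. (cmod (u $ j))\<^sup>2)"
    using assms(2) by (simp add: norm_vec_def L2_set_def)
  also have "\<dots> = (cmod s)\<^sup>2 * (\<Sum>j\<in>UNIV. p j)"
    by (simp add: * sum_distrib_left)
  also have "\<dots> = (cmod s)\<^sup>2"
    using assms(1) by (simp add: prob_simplex_def)
  finally show ?thesis
    using * by simp
qed

lemma torus_has_unit_representative: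
  fixes p :: "'n::finite \<Rightarrow> real"
  assumes "p \<in> prob_simplex"
  obtains u :: "complex^'n" where "norm u = 1" "cp_point u \<in> torus p"
proof
  define u :: "complex^'n" where "u = (\<chi> i. of_real (sqrt (p i)))"
  have u: "(cmod (u $ i))\<^sup>2 = p i" for i
    using assms by (simp add: u_def prob_simplex_def)
  show "norm u = 1"
    using assms by (simp add: norm_vec_def L2_set_def u prob_simplex_def)
  show "cp_point u \<in> torus p"
    using u by (auto simp: torus_def)
qed

text \<open>
  Uniqueness of the multiplier requires the torus to be nonempty: otherwise the quantification
  over its representatives would hold for every \<open>\<mu>\<close>.
\<close>

lemma linearization_multiplies_iff:
  assumes "p \<in> prob_simplex" "p k = 0"
  shows "linearization_multiplies (diag_mat l) p k \<mu> \<longleftrightarrow> \<mu> = growth_rate l k p"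
proof -
  have L: "frechet_derivative (residual_field (diag_mat l)) (at u) w $ k
        = growth_rate l k p *\<^sub>R (w $ k)"
      "frechet_derivative (residual_field (diag_mat l)) (at u) (axis k a)
        = growth_rate l k p *\<^sub>R axis k a"
    if "norm u = 1" "cp_point u \<in> torus p" for u w a
  proof -
    have moduli: "(\<lambda>j. (cmod (u $ j))\<^sup>2) = p"
      using torus_representative[OF assms(1) that] by auto
    then have "u $ k = 0"
      using assms(2) by (auto dest: fun_cong[of _ _ k])
    from residual_field_derivative[OF this] moduli show
      "frechet_derivative (residual_field (diag_mat l)) (at u) w $ k
        = growth_rate l k p *\<^sub>R (w $ k)"
      "frechet_derivative (residual_field (diag_mat l)) (at u) (axis k a)
        = growth_rate l k p *\<^sub>R axis k a"
      by auto
  qed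
  show ?thesis
  proof
    assume mult: "linearization_multiplies (diag_mat l) p k \<mu>"
    obtain u :: "complex^'a" where u: "norm u = 1" "cp_point u \<in> torus p"
      using torus_has_unit_representative[OF assms(1)] .
    have "growth_rate l k p *\<^sub>R axis k (1::complex) = \<mu> *\<^sub>R axis k 1"
      using mult u L(2)[OF u, of 1] by (simp add: linearization_multiplies_def Let_def)
    then show "\<mu> = growth_rate l k p"
      by (simp add: axis_eq_0_iff)
  next
    assume "\<mu> = growth_rate l k p"
    then show "linearization_multiplies (diag_mat l) p k \<mu>"
      by (simp add: linearization_multiplies_def Let_def L)
  qed
qed

theorem proposition5p1:
  fixes l :: "'n::finite \<Rightarrow> complex" and p :: "'n \<Rightarrow> real" and c :: complex and R :: real
    and k :: 'n
  assumes "inj l"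
    and "critical_torus (diag_mat l) p"
    and "c = z_of l p"
    and "R \<ge> 0" and "R\<^sup>2 = rho_of l p"
    and "k \<notin> active p"
  shows "(cmod (l k - c) < R \<longleftrightarrow> unstable_coord (diag_mat l) p k) \<and>
         (cmod (l k - c) > R \<longleftrightarrow> stable_coord (diag_mat l) p k)"
proof -
  have p: "p \<in> prob_simplex"
    using assms(2) by (simp add: critical_torus_def)
  then have "0 \<le> p k"
    by (simp add: prob_simplex_def)
  then have "p k = 0"
    using assms(6) by (simp add: active_def)
  note iff = linearization_multiplies_iff[OF p this, of l]
  have rate: "growth_rate l k p = 2 * (R\<^sup>2 - (cmod (l k - c))\<^sup>2)"
    by (simp add: growth_rate_def assms(3,5))
  have "cmod (l k - c) < R \<longleftrightarrow> (cmod (l k - c))\<^sup>2 < R\<^sup>2"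
    using assms(4) by (auto intro: power_strict_mono power2_less_imp_less)
  moreover have "R < cmod (l k - c) \<longleftrightarrow> R\<^sup>2 < (cmod (l k - c))\<^sup>2"
    using assms(4) by (auto intro: power_strict_mono power2_less_imp_less)
  ultimately show ?thesis
    by (simp add: unstable_coord_def stable_coord_def iff rate)
qed

end
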